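(* Let $K$ be an algebraically closed field of characteristic zero, let $\deg_1$ be a positive weighted homogeneous degree on $K[x_1,\dots,x_n]$, let $\Phi=(f_1,\dots,f_n)$ be a polynomial automorphism of $K^n$, and let $I=\{P\in K[x_1,\dots,x_n] : P(\overline{f_1},\dots,\overline{f_n})=0\}$ be the ideal of relations. Then there exists a nonzero locally nilpotent derivation $\partial$ of $K[x_1,\dots,x_n]$ such that $\partial(I)\subset I$. Moreover, if $I$ is principal, i.e. $I=(R)$, then $\partial(R)=0$.
   Context: A positive weighted homogeneous (p.w.h.) degree $\deg_1$ on $K[x_1,\dots,x_n]$ is the weighted degree assigning positive real weights $w_i$ to $x_i$. For a polynomial $f=\sum a_{k}x_1^{k_1}\cdots x_n^{k_n}$ of $\deg_1$-degree $d$, its leading term is $\overline{f}=\sum_{k_1w_1+\dots+k_nw_n=d}a_kx_1^{k_1}\cdots x_n^{k_n}$. A derivation $\partial$ is locally nilpotent if for every $f$ there is $k\ge 0$ with $\partial^k(f)=0$. *)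

theory Defs
  imports "HOL-Library.Poly_Mapping" "HOL-Computational_Algebra.Polynomial"
begin

text \<open>Multivariate polynomials over K in the variables indexed by a finite type 'v
  (so n = CARD('v)), represented as finitely supported maps from monomials
  (finitely supported exponent vectors) to coefficients. The ring structure is the
  one of Poly_Mapping (convolution product).\<close>

type_synonym ('v, 'a) mpoly = "('v \<Rightarrow>\<^sub>0 nat) \<Rightarrow>\<^sub>0 'a"

definition Const :: "'a::zero \<Rightarrow> ('v, 'a) mpoly" where
  "Const c = Poly_Mapping.single 0 c"

definition Var :: "'v \<Rightarrow> ('v, 'a::{zero,one}) mpoly" where
  "Var v = Poly_Mapping.single (Poly_Mapping.single v 1) 1"

definition subst :: "('v::finite \<Rightarrow> ('v, 'a::comm_ring_1) mpoly) \<Rightarrow> ('v, 'a) mpoly \<Rightarrow> ('v, 'a) mpoly" where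
  "subst g P = (\<Sum>m\<in>Poly_Mapping.keys P. Const (Poly_Mapping.lookup P (m :: 'v \<Rightarrow>\<^sub>0 nat)) * (\<Prod>v\<in>UNIV. g v ^ Poly_Mapping.lookup m v))"

definition poly_automorphism :: "('v::finite \<Rightarrow> ('v, 'a::comm_ring_1) mpoly) \<Rightarrow> bool" where
  "poly_automorphism f \<longleftrightarrow> (\<exists>g. (\<forall>i. subst g (f i) = Var i) \<and> (\<forall>i. subst f (g i) = Var i))"

definition mon_wdeg :: "('v::finite \<Rightarrow> real) \<Rightarrow> ('v \<Rightarrow>\<^sub>0 nat) \<Rightarrow> real" where
  "mon_wdeg w m = (\<Sum>v\<in>UNIV. w v * real (Poly_Mapping.lookup m v))"

definition wdeg :: "('v::finite \<Rightarrow> real) \<Rightarrow> ('v, 'a::zero) mpoly \<Rightarrow> real" where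
  "wdeg w f = Max (mon_wdeg w ` Poly_Mapping.keys f)"

definition lead_form :: "('v::finite \<Rightarrow> real) \<Rightarrow> ('v, 'a::comm_monoid_add) mpoly \<Rightarrow> ('v, 'a) mpoly" where
  "lead_form w f = (\<Sum>m\<in>Poly_Mapping.keys f. if mon_wdeg w m = wdeg w f then Poly_Mapping.single m (Poly_Mapping.lookup f m) else 0)"

definition is_derivation :: "(('v, 'a::comm_ring_1) mpoly \<Rightarrow> ('v, 'a) mpoly) \<Rightarrow> bool" where
  "is_derivation D \<longleftrightarrow>
     (\<forall>p q. D (p + q) = D p + D q) \<and>
     (\<forall>c p. D (Const c * p) = Const c * D p) \<and>
     (\<forall>p q. D (p * q) = p * D q + q * D p)"

definition locally_nilpotent :: "(('v, 'a::comm_ring_1) mpoly \<Rightarrow> ('v, 'a) mpoly) \<Rightarrow> bool" where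
  "locally_nilpotent D \<longleftrightarrow> (\<forall>p. \<exists>k. (D ^^ k) p = 0)"

definition relation_ideal :: "('v::finite \<Rightarrow> real) \<Rightarrow> ('v \<Rightarrow> ('v, 'a::comm_ring_1) mpoly) \<Rightarrow> ('v, 'a) mpoly set" where
  "relation_ideal w f = {P. subst (\<lambda>i. lead_form w (f i)) P = 0}"

end

(*
  Conjugating d/dx_i by the automorphism gives a locally nilpotent derivation D. Give y_j the weight
  d_j = deg f_j and let T be the top homogeneous part of D, of degree e; it is nonzero and again locally
  nilpotent. If the leading form of some f_j involves x_i, then e >= -w_i. For P in I homogeneous of
  degree r, P(f) has degree < r, so (D P)(f) = d/dx_i (P(f)) has degree < r - w_i <= r + e, which says
  that the part T P of D P of degree r + e lies in I; and I is homogeneous for the weights d_j. Finally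
  T R = R Q forces T R = 0, since the nilpotency order is additive on products.
*)

theory Submission
  imports Defs
begin

section \<open>Multivariate polynomials\<close>

lemma mpoly_sum_single: "(\<Sum>m\<in>Poly_Mapping.keys p. Poly_Mapping.single m (Poly_Mapping.lookup p m)) = p"
  by (rule poly_mapping_eqI)
     (auto simp: lookup_sum lookup_single when_def in_keys_iff sum.delta)

lemma mpoly_induct_single [case_names single add]:
  assumes "\<And>m c. P (Poly_Mapping.single m c)" "\<And>p q. P p \<Longrightarrow> P q \<Longrightarrow> P (p + q)"
  shows "P (p :: ('v, 'a::comm_ring_1) mpoly)"
proof -
  have "P (\<Sum>m\<in>A. Poly_Mapping.single m (Poly_Mapping.lookup p m))" if "finite A" for A
    using that
  proof induction
    case empty
    show ?case using assms(1)[of 0 0] by simp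
  qed (simp add: assms)
  from this[of "Poly_Mapping.keys p"] show ?thesis
    by (simp add: mpoly_sum_single)
qed

lemma Const_0 [simp]: "Const 0 = 0"
  by (simp add: Const_def)

lemma Const_1: "Const 1 = (1 :: ('v, 'a::comm_ring_1) mpoly)"
  by (simp add: Const_def)

lemma Const_mult_single: "Const c * Poly_Mapping.single m (d::'a::comm_ring_1) = Poly_Mapping.single m (c * d)"
  by (simp add: Const_def mult_single)

lemma Const_mult: "Const (c * d) = Const c * Const (d::'a::comm_ring_1)"
  by (simp add: Const_def mult_single)

lemma Var_power: "(Var v :: ('v, 'a::comm_ring_1) mpoly) ^ k = Poly_Mapping.single (Poly_Mapping.single v k) 1"
  by (induction k) (simp_all add: Var_def mult_single single_add[symmetric])

lemma single_eq_Const_Var: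
  "Poly_Mapping.single m (c::'a::comm_ring_1) =
    Const c * (\<Prod>v\<in>(UNIV::'v::finite set). Var v ^ Poly_Mapping.lookup m v)"
proof -
  have "(\<Prod>v\<in>A. Var v ^ Poly_Mapping.lookup m v) =
      Poly_Mapping.single (\<Sum>v\<in>A. Poly_Mapping.single v (Poly_Mapping.lookup m v)) (1::'a)"
    if "finite A" for A :: "'v set"
    using that by induction (simp_all add: Var_power mult_single)
  moreover have "(\<Sum>v\<in>UNIV. Poly_Mapping.single v (Poly_Mapping.lookup m v)) = m"
    by (rule poly_mapping_eqI) (simp add: lookup_sum lookup_single when_def sum.delta)
  ultimately show ?thesis
    by (simp add: Const_mult_single)
qed

text \<open>Constants and variables generate the algebra, so identities between homomorphisms or
  derivations can be checked on them alone.\<close>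

lemma mpoly_induct [case_names Const Var add mult]:
  assumes "\<And>c. P (Const c)" "\<And>v. P (Var v)"
    and add: "\<And>p q. P p \<Longrightarrow> P q \<Longrightarrow> P (p + q)" and mult: "\<And>p q. P p \<Longrightarrow> P q \<Longrightarrow> P (p * q)"
  shows "P (p :: ('v::finite, 'a::comm_ring_1) mpoly)"
proof (induction p rule: mpoly_induct_single)
  case (single m c)
  have one: "P 1"
    using assms(1)[of 1] by (simp add: Const_1)
  have pow: "P (Var v ^ k)" for v k
    by (induction k) (simp_all add: one assms)
  have "P (\<Prod>v\<in>A. Var v ^ Poly_Mapping.lookup m v)" if "finite A" for A
    using that by induction (simp_all add: one pow mult)
  then show ?case
    by (simp add: single_eq_Const_Var assms)
qed (rule add)

section \<open>Substitution as a ring homomorphism\<close>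

lemma subst_single:
  "subst g (Poly_Mapping.single m c) = Const c * (\<Prod>v\<in>UNIV. g v ^ Poly_Mapping.lookup m v)"
  by (simp add: subst_def)

lemma subst_add: "subst g (p + q) = subst g p + subst g q"
  unfolding subst_def
  by (rule setsum_keys_plus_distrib) (simp_all add: Const_def single_add distrib_right)

lemma subst_0 [simp]: "subst g 0 = 0"
  by (simp add: subst_def)

lemma subst_sum: "subst g (sum h A) = (\<Sum>x\<in>A. subst g (h x))"
  by (induction A rule: infinite_finite_induct) (simp_all add: subst_add)

lemma subst_Const: "subst g (Const c) = Const c"
  using subst_single[of g 0 c] by (simp add: Const_def)

lemma subst_Var: "subst g (Var v) = g v"
proof -
  have "g u ^ Poly_Mapping.lookup (Poly_Mapping.single v 1) u = (if u = v then g u else 1)" for u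
    by (simp add: lookup_single when_def)
  then show ?thesis
    by (simp add: Var_def subst_single Const_1)
qed

lemma subst_mult: "subst g (p * q) = subst g p * subst g q"
proof (induction p rule: mpoly_induct_single)
  case (single m c)
  show ?case
  proof (induction q rule: mpoly_induct_single)
    case (single n d)
    show ?case
      by (simp add: mult_single Const_mult subst_single lookup_add power_add prod.distrib ac_simps)
  qed (simp add: distrib_left subst_add)
qed (simp add: distrib_right subst_add)

text \<open>The composite \<open>subst g o subst f\<close> is a homomorphism fixing constants and
  variables. This turns an automorphism, given by conditions on coordinates only, into mutually
  inverse ring maps.\<close>

lemma subst_inverse:
  assumes "\<And>i. subst g (f i) = Var i"
  shows "subst g (subst f p) = p"
  by (induction p rule: mpoly_induct) (simp_all add: subst_Const subst_Var subst_add subst_mult assms)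

section \<open>Gradings by weight\<close>

text \<open>Unlike \<open>lead_form\<close>, this is additive for each fixed r, and it is 0 when
  nothing of weight r occurs. A drop in degree can thus be written as the vanishing of a
  component.\<close>

definition hcomp :: "('v::finite \<Rightarrow> real) \<Rightarrow> real \<Rightarrow> ('v, 'a::zero) mpoly \<Rightarrow> ('v, 'a) mpoly" where
  "hcomp w r p = Poly_Mapping.mapp (\<lambda>m c. c when mon_wdeg w m = r) p"

text \<open>An upper bound in place of an exact degree: it is stable under sums and holds for 0 with
  every r, so the unspecified value \<open>wdeg w 0\<close> causes no trouble.\<close>

definition wle :: "('v::finite \<Rightarrow> real) \<Rightarrow> real \<Rightarrow> ('v, 'a::zero) mpoly \<Rightarrow> bool" where
  "wle w r p \<longleftrightarrow> (\<forall>m\<in>Poly_Mapping.keys p. mon_wdeg w m \<le> r)"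

lemma mon_wdeg_0 [simp]: "mon_wdeg w 0 = 0"
  by (simp add: mon_wdeg_def)

lemma mon_wdeg_add: "mon_wdeg w (m + n) = mon_wdeg w m + mon_wdeg w n"
  by (simp add: mon_wdeg_def lookup_add distrib_left sum.distrib)

lemma mon_wdeg_single [simp]: "mon_wdeg w (Poly_Mapping.single v k) = w v * real k"
  by (simp add: mon_wdeg_def lookup_single when_def if_distrib sum.delta cong: if_cong)

lemma lookup_hcomp:
  "Poly_Mapping.lookup (hcomp w r p) m = (Poly_Mapping.lookup p m when mon_wdeg w m = r)"
  by (auto simp: hcomp_def lookup_mapp when_def in_keys_iff)

lemma keys_hcomp: "Poly_Mapping.keys (hcomp w r p) = {m \<in> Poly_Mapping.keys p. mon_wdeg w m = r}"
  by (auto simp: in_keys_iff lookup_hcomp when_def split: if_splits)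

lemma hcomp_0 [simp]: "hcomp w r 0 = 0"
  by (rule poly_mapping_eqI) (simp add: lookup_hcomp)

lemma hcomp_add: "hcomp w r (p + q) = hcomp w r p + hcomp w r (q :: ('v::finite, 'a::comm_ring_1) mpoly)"
  by (rule poly_mapping_eqI) (simp add: lookup_hcomp lookup_add when_add_distrib)

lemma hcomp_sum:
  "hcomp w r (sum h A) = (\<Sum>x\<in>A. hcomp w r (h x :: ('v::finite, 'a::comm_ring_1) mpoly))"
  by (induction A rule: infinite_finite_induct) (simp_all add: hcomp_add)

lemma hcomp_hcomp: "hcomp w r (hcomp w s p) = (if r = s then hcomp w r p else 0)"
  by (rule poly_mapping_eqI) (auto simp: lookup_hcomp when_def)

lemma hcomp_single:
  "hcomp w r (Poly_Mapping.single m c) = (if mon_wdeg w m = r then Poly_Mapping.single m c else 0)"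
  by (rule poly_mapping_eqI) (auto simp: lookup_hcomp lookup_single when_def)

lemma hcomp_eq_0:
  assumes "wle w s p" "s < r"
  shows "hcomp w r p = 0"
  using assms by (intro poly_mapping_eqI) (force simp: lookup_hcomp when_def wle_def in_keys_iff)

lemma sum_hcomp:
  "(\<Sum>r\<in>mon_wdeg w ` Poly_Mapping.keys p. hcomp w r p) = (p :: ('v::finite, 'a::comm_ring_1) mpoly)"
  by (rule poly_mapping_eqI)
     (auto simp: lookup_sum lookup_hcomp when_def sum.delta' in_keys_iff image_iff)

lemma wle_0 [simp]: "wle w r 0"
  by (simp add: wle_def)

lemma wle_add: "wle w r p \<Longrightarrow> wle w r q \<Longrightarrow> wle w r (p + q)"
  using keys_add[of p q] by (auto simp: wle_def)

lemma wle_sum: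
  assumes "\<And>x. x \<in> A \<Longrightarrow> wle w r (h x :: ('v::finite, 'a::comm_ring_1) mpoly)"
  shows "wle w r (sum h A)"
  using assms by (induction A rule: infinite_finite_induct) (simp_all add: wle_add)

lemma wle_mono: "wle w r p \<Longrightarrow> r \<le> s \<Longrightarrow> wle w s p"
  by (force simp: wle_def)

lemma wle_hcomp: "wle w r (hcomp w r p)"
  by (auto simp: wle_def keys_hcomp)

lemma wle_mult: "wle w r p \<Longrightarrow> wle w s q \<Longrightarrow> wle w (r + s) (p * q)"
  using keys_mult[of p q] by (force simp: wle_def mon_wdeg_add)

text \<open>Split off the components of weight r and s. In the expanded product every other term has
  a factor lying strictly below its bound, so it cannot reach weight \<open>r + s\<close>.\<close>

lemma hcomp_mult:
  fixes p q :: "('v::finite, 'a::comm_ring_1) mpoly"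
  assumes "wle w r p" "wle w s q"
  shows "hcomp w (r + s) (p * q) = hcomp w r p * hcomp w s q"
proof -
  have *: "hcomp w (r + s) (a * b) = 0"
    if ab: "wle w r a" "wle w s b"
      "(\<forall>m\<in>Poly_Mapping.keys a. mon_wdeg w m < r) \<or> (\<forall>m\<in>Poly_Mapping.keys b. mon_wdeg w m < s)"
    for a b :: "('v, 'a) mpoly"
  proof -
    have "mon_wdeg w m < r + s" if "m \<in> Poly_Mapping.keys (a * b)" for m
      using ab that keys_mult[of a b]
      by (fastforce simp: wle_def mon_wdeg_add)
    then have "Poly_Mapping.keys (hcomp w (r + s) (a * b)) = {}"
      by (fastforce simp: keys_hcomp)
    then show ?thesis by simp
  qed
  define p' q' where "p' = p - hcomp w r p" and "q' = q - hcomp w s q"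
  have low: "wle w t (x - hcomp w t x) \<and> (\<forall>m\<in>Poly_Mapping.keys (x - hcomp w t x). mon_wdeg w m < t)"
    if "wle w t x" for t and x :: "('v, 'a) mpoly"
    using that by (force simp: wle_def in_keys_iff lookup_minus lookup_hcomp when_def split: if_splits)
  note lp = low[OF assms(1), folded p'_def] and lq = low[OF assms(2), folded q'_def]
  have hom: "hcomp w (r + s) (hcomp w r p * hcomp w s q) = hcomp w r p * hcomp w s q"
    using keys_mult[of "hcomp w r p" "hcomp w s q"]
    by (intro poly_mapping_eqI)
       (fastforce simp: lookup_hcomp when_def keys_hcomp mon_wdeg_add in_keys_iff)
  have "p * q = hcomp w r p * hcomp w s q + hcomp w r p * q' + p' * q"
    by (simp add: p'_def q'_def algebra_simps)
  also have "hcomp w (r + s) \<dots> = hcomp w r p * hcomp w s q"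
    using lp lq assms by (simp add: hcomp_add hom * wle_hcomp)
  finally show ?thesis .
qed

lemma lead_form_eq_hcomp: "lead_form w p = hcomp w (wdeg w p) (p :: ('v::finite, 'a::comm_ring_1) mpoly)"
proof -
  have "hcomp w (wdeg w p) (\<Sum>m\<in>Poly_Mapping.keys p. Poly_Mapping.single m (Poly_Mapping.lookup p m))
      = lead_form w p"
    by (simp add: lead_form_def hcomp_sum hcomp_single)
  then show ?thesis
    by (simp add: mpoly_sum_single)
qed

lemma hcomp_lead_form:
  "hcomp w (wdeg w p) (lead_form w p) = lead_form w (p :: ('v::finite, 'a::comm_ring_1) mpoly)"
  by (simp add: lead_form_eq_hcomp hcomp_hcomp)

lemma wle_wdeg: "wle w (wdeg w p) p"
  by (simp add: wle_def wdeg_def)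

lemma hcomp_wdeg_nonzero:
  assumes "p \<noteq> 0"
  shows "hcomp w (wdeg w p) p \<noteq> 0"
proof -
  have "wdeg w p \<in> mon_wdeg w ` Poly_Mapping.keys p"
    unfolding wdeg_def using assms by (intro Max_in) auto
  then have "Poly_Mapping.keys (hcomp w (wdeg w p) p) \<noteq> {}"
    by (auto simp: keys_hcomp)
  then show ?thesis by auto
qed

lemma wle_Const: "wle w 0 (Const c)" and hcomp_Const: "hcomp w 0 (Const c) = Const c"
  by (auto simp: wle_def Const_def hcomp_single split: if_splits)

lemma wle_power: "wle w r p \<Longrightarrow> wle w (r * real k) (p ^ k :: ('v::finite, 'a::comm_ring_1) mpoly)"
proof (induction k)
  case 0
  show ?case using wle_Const[of w "1::'a"] by (simp add: Const_1)
next
  case (Suc k)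
  then show ?case using wle_mult[of w r p "r * real k" "p ^ k"]
    by (simp add: algebra_simps)
qed

lemma hcomp_power:
  assumes "wle w r p"
  shows "hcomp w (r * real k) (p ^ k :: ('v::finite, 'a::comm_ring_1) mpoly) = hcomp w r p ^ k"
proof (induction k)
  case 0
  show ?case using hcomp_Const[of w "1::'a"] by (simp add: Const_1)
next
  case (Suc k)
  then show ?case using hcomp_mult[OF assms wle_power[OF assms, of k]]
    by (simp add: algebra_simps)
qed

section \<open>Top components of products and of substitutions\<close>

lemma wle_hcomp_prod:
  fixes h :: "'b \<Rightarrow> ('v::finite, 'a::comm_ring_1) mpoly"
  assumes "finite A" "\<And>x. wle w (r x) (h x)"
  shows "wle w (sum r A) (prod h A) \<and> hcomp w (sum r A) (prod h A) = (\<Prod>x\<in>A. hcomp w (r x) (h x))"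
  using assms(1)
proof induction
  case empty
  show ?case using wle_Const[of w "1::'a"] hcomp_Const[of w "1::'a"] by (simp add: Const_1)
next
  case (insert x A)
  then show ?case
    using assms(2)[of x] by (auto intro: wle_mult simp: hcomp_mult)
qed

text \<open>Giving the variable v the weight \<open>d v\<close>, a bound for \<open>h v\<close>,
  makes substitution compatible with the weight filtrations. On a monomial this is
  \<open>hcomp_mult\<close> applied to its powers.\<close>

lemma wle_hcomp_subst_single:
  fixes h :: "'v::finite \<Rightarrow> ('v, 'a::comm_ring_1) mpoly"
  assumes "\<And>v. wle w (d v) (h v)"
  shows "wle w (mon_wdeg d m) (subst h (Poly_Mapping.single m c))"
    and "hcomp w (mon_wdeg d m) (subst h (Poly_Mapping.single m c))
      = subst (\<lambda>v. hcomp w (d v) (h v)) (Poly_Mapping.single m c)"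
proof -
  note * = wle_hcomp_prod[of UNIV w "\<lambda>v. d v * real (Poly_Mapping.lookup m v)"
      "\<lambda>v. h v ^ Poly_Mapping.lookup m v", OF finite wle_power[OF assms]]
  show "wle w (mon_wdeg d m) (subst h (Poly_Mapping.single m c))"
    using wle_mult[OF wle_Const conjunct1[OF *], of c] by (simp add: mon_wdeg_def subst_single)
  show "hcomp w (mon_wdeg d m) (subst h (Poly_Mapping.single m c))
      = subst (\<lambda>v. hcomp w (d v) (h v)) (Poly_Mapping.single m c)"
    using hcomp_mult[OF wle_Const conjunct1[OF *], of c] conjunct2[OF *]
    by (simp add: mon_wdeg_def subst_single hcomp_Const hcomp_power assms)
qed

lemma subst_alt: "subst h p = (\<Sum>m\<in>Poly_Mapping.keys p. subst h (Poly_Mapping.single m (Poly_Mapping.lookup p m)))"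
  by (simp flip: subst_sum add: mpoly_sum_single)

lemma wle_subst:
  fixes h :: "'v::finite \<Rightarrow> ('v, 'a::comm_ring_1) mpoly"
  assumes "\<And>v. wle w (d v) (h v)" "wle d r p"
  shows "wle w r (subst h p)"
  unfolding subst_alt[of h p]
  using assms wle_mono[OF wle_hcomp_subst_single(1)[of w d h, OF assms(1)]]
  by (intro wle_sum) (auto simp: wle_def[of d])

text \<open>Monomials of weight below r are sent below r and contribute nothing; those of weight
  exactly r contribute their top components.\<close>

lemma hcomp_subst:
  fixes h :: "'v::finite \<Rightarrow> ('v, 'a::comm_ring_1) mpoly"
  assumes "\<And>v. wle w (d v) (h v)" "wle d r p"
  shows "hcomp w r (subst h p) = subst (\<lambda>v. hcomp w (d v) (h v)) (hcomp d r p)"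
proof -
  have "hcomp w r (subst h (Poly_Mapping.single m c))
      = subst (\<lambda>v. hcomp w (d v) (h v)) (hcomp d r (Poly_Mapping.single m c))"
    if "mon_wdeg d m \<le> r" for m c
    using that wle_hcomp_subst_single[of w d h m c, OF assms(1)]
      hcomp_eq_0[of w "mon_wdeg d m" "subst h (Poly_Mapping.single m c)" r]
    by (cases "mon_wdeg d m = r") (auto simp: hcomp_single)
  then have "hcomp w r (subst h p) = subst (\<lambda>v. hcomp w (d v) (h v))
      (hcomp d r (\<Sum>m\<in>Poly_Mapping.keys p. Poly_Mapping.single m (Poly_Mapping.lookup p m)))"
    using assms(2) by (simp add: subst_alt[of h p] hcomp_sum subst_sum wle_def)
  then show ?thesis
    by (simp add: mpoly_sum_single)
qed

text \<open>Homogeneous \<open>h v\<close> send each monomial to a homogeneous polynomial, so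
  substitution is a graded map and respects every component, not only the top one.\<close>

lemma hcomp_subst_homog:
  fixes h :: "'v::finite \<Rightarrow> ('v, 'a::comm_ring_1) mpoly"
  assumes "\<And>v. hcomp w (d v) (h v) = h v"
  shows "hcomp w r (subst h p) = subst h (hcomp d r p)"
proof (induction p rule: mpoly_induct_single)
  case (single m c)
  have wle: "wle w (d v) (h v)" for v
    using wle_hcomp[of w "d v" "h v"] assms by simp
  have *: "hcomp w (mon_wdeg d m) (subst h (Poly_Mapping.single m c)) = subst h (Poly_Mapping.single m c)"
    using wle_hcomp_subst_single(2)[of w d h m c, OF wle] assms by simp
  show ?case
    using * hcomp_hcomp[of w r "mon_wdeg d m" "subst h (Poly_Mapping.single m c)"]
    by (auto simp: hcomp_single)
qed (simp add: hcomp_add subst_add)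

text \<open>The type of monomials carries no compatible linear order, so the absence of zero divisors
  is obtained by passing to leading components with respect to one variable at a time.\<close>

lemma mpoly_mult_nonzero_aux:
  fixes p q :: "('v::finite, 'a::idom) mpoly"
  assumes "finite V" "p \<noteq> 0" "q \<noteq> 0"
    "\<And>m n v. m \<in> Poly_Mapping.keys p \<Longrightarrow> n \<in> Poly_Mapping.keys p \<Longrightarrow> v \<notin> V \<Longrightarrow>
      Poly_Mapping.lookup m v = Poly_Mapping.lookup n v"
    "\<And>m n v. m \<in> Poly_Mapping.keys q \<Longrightarrow> n \<in> Poly_Mapping.keys q \<Longrightarrow> v \<notin> V \<Longrightarrow>
      Poly_Mapping.lookup m v = Poly_Mapping.lookup n v"
  shows "p * q \<noteq> 0"
  using assms
proof (induction V arbitrary: p q)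
  case empty
  \<comment> \<open>With no variable left to vary, all exponent vectors coincide and the polynomial
    is a single nonzero term.\<close>
  have mono: "\<exists>m c. c \<noteq> 0 \<and> x = Poly_Mapping.single m c"
    if "x \<noteq> 0" and eq: "\<And>m n v. m \<in> Poly_Mapping.keys x \<Longrightarrow> n \<in> Poly_Mapping.keys x \<Longrightarrow>
      Poly_Mapping.lookup m v = Poly_Mapping.lookup n v" for x :: "('v, 'a) mpoly"
  proof -
    obtain m where m: "m \<in> Poly_Mapping.keys x"
      using \<open>x \<noteq> 0\<close> keys_eq_empty by blast
    have "n = m" if "n \<in> Poly_Mapping.keys x" for n
      using eq[OF that m] by (rule poly_mapping_eqI)
    then have K: "Poly_Mapping.keys x = {m}"
      using m by blast
    have "Poly_Mapping.single m (Poly_Mapping.lookup x m) = x"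
      using mpoly_sum_single[of x] unfolding K by simp
    moreover have "Poly_Mapping.lookup x m \<noteq> 0"
      using m by (simp add: in_keys_iff)
    ultimately show ?thesis by metis
  qed
  obtain m c n d where "c \<noteq> 0" "d \<noteq> 0" "p = Poly_Mapping.single m c" "q = Poly_Mapping.single n d"
    using mono[of p] mono[of q] empty by blast
  moreover from this have "Poly_Mapping.lookup (p * q) (m + n) \<noteq> 0"
    by (simp add: mult_single)
  ultimately show ?case by auto
next
  case (insert u V)
  define w :: "'v \<Rightarrow> real" where "w v = (if v = u then 1 else 0)" for v
  have w: "mon_wdeg w m = real (Poly_Mapping.lookup m u)" for m
    by (simp add: mon_wdeg_def w_def if_distrib[of "\<lambda>x. x * _"] sum.delta cong: if_cong)
  have "hcomp w (wdeg w p) p * hcomp w (wdeg w q) q \<noteq> 0"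
  proof (rule insert.IH)
    show "hcomp w (wdeg w p) p \<noteq> 0" "hcomp w (wdeg w q) q \<noteq> 0"
      using hcomp_wdeg_nonzero insert.prems by auto
  next
    fix m n v
    assume "m \<in> Poly_Mapping.keys (hcomp w (wdeg w p) p)" "n \<in> Poly_Mapping.keys (hcomp w (wdeg w p) p)" "v \<notin> V"
    then show "Poly_Mapping.lookup m v = Poly_Mapping.lookup n v"
      using insert.prems(3)[of m n v] by (cases "v = u") (simp_all add: keys_hcomp w)
  next
    fix m n v
    assume "m \<in> Poly_Mapping.keys (hcomp w (wdeg w q) q)" "n \<in> Poly_Mapping.keys (hcomp w (wdeg w q) q)" "v \<notin> V"
    then show "Poly_Mapping.lookup m v = Poly_Mapping.lookup n v"
      using insert.prems(4)[of m n v] by (cases "v = u") (simp_all add: keys_hcomp w)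
  qed
  then have "hcomp w (wdeg w p + wdeg w q) (p * q) \<noteq> 0"
    by (simp add: hcomp_mult wle_wdeg)
  then show ?case by auto
qed

lemma mpoly_mult_eq_0_iff:
  fixes p q :: "('v::finite, 'a::idom) mpoly"
  shows "p * q = 0 \<longleftrightarrow> p = 0 \<or> q = 0"
  using mpoly_mult_nonzero_aux[of UNIV p q] by auto

section \<open>Derivations\<close>

lemma derivation_add: "is_derivation D \<Longrightarrow> D (p + q) = D p + D q"
  by (simp add: is_derivation_def)

lemma derivation_mult: "is_derivation D \<Longrightarrow> D (p * q) = p * D q + q * D p"
  by (simp add: is_derivation_def)

lemma derivation_0:
  assumes "is_derivation D"
  shows "D 0 = 0"
  using derivation_add[OF assms, of 0 0] by simp

lemma derivation_sum:
  assumes "is_derivation D"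
  shows "D (sum h A) = (\<Sum>x\<in>A. D (h x))"
  by (induction A rule: infinite_finite_induct) (simp_all add: derivation_0 derivation_add assms)

lemma derivation_Const:
  fixes D :: "('v, 'a::comm_ring_1) mpoly \<Rightarrow> ('v, 'a) mpoly"
  assumes "is_derivation D"
  shows "D (Const c) = 0"
proof -
  have "D 1 = 0"
    using derivation_mult[OF assms, of 1 1] by simp
  moreover have "D (Const c * 1) = Const c * D 1"
    using assms unfolding is_derivation_def by blast
  ultimately show ?thesis by simp
qed

lemma derivation_funpow_0: "is_derivation D \<Longrightarrow> (D ^^ k) 0 = 0"
  by (induction k) (simp_all add: derivation_0)

lemma derivation_funpow_add: "is_derivation D \<Longrightarrow> (D ^^ k) (p + q) = (D ^^ k) p + (D ^^ k) q"
  by (induction k arbitrary: p q) (simp_all add: derivation_add)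

lemma derivation_funpow_eq_0_mono:
  assumes "is_derivation D" "(D ^^ k) p = 0" "k \<le> l"
  shows "(D ^^ l) p = 0"
proof -
  have "(D ^^ (l - k + k)) p = 0"
    unfolding funpow_add using assms by (simp add: derivation_funpow_0)
  then show ?thesis using assms by simp
qed

lemma nilpotent_on_add:
  assumes "is_derivation D" "\<exists>k. (D ^^ k) p = 0" "\<exists>k. (D ^^ k) q = 0"
  shows "\<exists>k. (D ^^ k) (p + q) = 0"
proof -
  obtain k l where "(D ^^ k) p = 0" "(D ^^ l) q = 0"
    using assms by blast
  then have "(D ^^ (k + l)) p = 0" "(D ^^ (k + l)) q = 0"
    using derivation_funpow_eq_0_mono[OF assms(1)] by auto
  then show ?thesis
    using derivation_funpow_add[OF assms(1)] by (metis add.right_neutral)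
qed

lemma nilpotent_on_sum:
  assumes "is_derivation D" "\<And>x. x \<in> A \<Longrightarrow> \<exists>k. (D ^^ k) (h x) = 0"
  shows "\<exists>k. (D ^^ k) (sum h A) = 0"
  using assms(2)
proof (induction A rule: infinite_finite_induct)
  case (insert x A)
  then show ?case
    using nilpotent_on_add[OF assms(1), of "h x" "sum h A"] by simp
qed (auto intro: derivation_funpow_0[OF assms(1)])

text \<open>In the Leibniz expansion every term other than this one differentiates p more than k
  times or q more than l times. The induction applies D once: \<open>p * D q\<close> and
  \<open>q * D p\<close> have one of the two orders lowered, and Pascal's rule adds their
  coefficients.\<close>

lemma Leibniz_top:
  assumes D: "is_derivation D" and "(D ^^ Suc k) p = 0" "(D ^^ Suc l) q = 0"
  shows "(D ^^ (k + l)) (p * q) = of_nat ((k + l) choose k) * ((D ^^ k) p * (D ^^ l) q)"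
  using assms(2,3)
proof (induction "k + l" arbitrary: k l p q)
  case 0
  then show ?case by simp
next
  case (Suc n)
  have sum: "(D ^^ Suc n) (p * q) = (D ^^ n) (p * D q) + (D ^^ n) (q * D p)"
    by (simp add: funpow_Suc_right derivation_mult D derivation_funpow_add del: funpow.simps)
  show ?case
  proof (cases "k = 0 \<or> l = 0")
    case True
    then show ?thesis
    proof
      assume "k = 0"
      then have "D p = 0" "l = Suc n"
        using Suc by auto
      then show ?thesis
        using Suc.hyps(1)[of 0 n p "D q"] Suc.prems sum \<open>k = 0\<close>
        by (simp add: derivation_funpow_0 D funpow_swap1)
    next
      assume "l = 0"
      then have "D q = 0" "k = Suc n"
        using Suc by auto
      then show ?thesis
        using Suc.hyps(1)[of 0 n q "D p"] Suc.prems sum \<open>l = 0\<close>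
        by (simp add: derivation_funpow_0 D funpow_swap1 mult.commute)
    qed
  next
    case False
    then obtain k' l' where kl: "k = Suc k'" "l = Suc l'"
      by (auto simp: gr0_conv_Suc)
    have "(D ^^ n) (p * D q) = of_nat (n choose k) * ((D ^^ k) p * (D ^^ l) q)"
      using Suc.hyps(1)[of k l' p "D q"] Suc.prems Suc.hyps(2)
      by (simp add: kl funpow_swap1)
    moreover have "(D ^^ n) (q * D p) = of_nat (n choose k') * ((D ^^ k) p * (D ^^ l) q)"
      using Suc.hyps(1)[of k' l "D p" q] Suc.prems Suc.hyps(2)
      by (simp add: kl funpow_swap1 mult.commute)
    moreover have "k + l = Suc n" "Suc n choose k = (n choose k') + (n choose k)"
      using Suc.hyps(2) kl by simp_all
    ultimately show ?thesis
      using sum by (simp add: distrib_right add.commute del: funpow.simps)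
  qed
qed

text \<open>Supplies the nilpotency order of a nonzero polynomial.\<close>

lemma locally_nilpotent_last:
  assumes "locally_nilpotent D" "p \<noteq> 0"
  obtains k where "(D ^^ k) p \<noteq> 0" "(D ^^ Suc k) p = 0"
proof -
  let ?P = "\<lambda>k. (D ^^ k) p = 0"
  have ex: "\<exists>k. ?P k"
    using assms by (auto simp: locally_nilpotent_def)
  have "?P (LEAST k. ?P k)"
    using ex by (rule LeastI_ex)
  moreover from this obtain k where k: "(LEAST k. ?P k) = Suc k"
    using assms(2) by (cases "LEAST k. ?P k") auto
  moreover have "\<not> ?P k"
    using not_less_Least[of k ?P] k by simp
  ultimately show ?thesis
    using that by simp
qed

text \<open>Let k and l be the orders of p and q. Then \<open>(D ^^ (k + l)) (p * q)\<close> is a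
  nonzero binomial coefficient times a product of nonzero polynomials, yet it equals
  \<open>(D ^^ (Suc k + l)) p\<close>, which is 0.\<close>

lemma locally_nilpotent_dvd_imp_0:
  fixes D :: "('v::finite, 'a::{idom, ring_char_0}) mpoly \<Rightarrow> ('v, 'a) mpoly"
  assumes D: "is_derivation D" "locally_nilpotent D" and eq: "D p = p * q"
  shows "D p = 0"
proof (rule ccontr)
  assume "D p \<noteq> 0"
  then have "p \<noteq> 0" "q \<noteq> 0"
    using eq by auto
  then obtain k l where kl: "(D ^^ k) p \<noteq> 0" "(D ^^ Suc k) p = 0" "(D ^^ l) q \<noteq> 0" "(D ^^ Suc l) q = 0"
    using locally_nilpotent_last[OF D(2)] by metis
  have "(D ^^ (k + l)) (p * q) = (D ^^ (Suc k + l)) p"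
    by (simp flip: eq add: funpow_swap1)
  also have "\<dots> = 0"
    by (rule derivation_funpow_eq_0_mono[OF D(1) kl(2)]) simp
  finally show False
    using Leibniz_top[OF D(1) kl(2,4)] kl(1,3) by (simp add: mpoly_mult_eq_0_iff)
qed

section \<open>Partial derivatives\<close>

text \<open>Subtraction of exponents is truncated: if v does not occur in m, the exponent stays m,
  but the coefficient is then 0.\<close>

definition pdiff :: "'v \<Rightarrow> ('v, 'a::comm_ring_1) mpoly \<Rightarrow> ('v, 'a) mpoly" where
  "pdiff v p = (\<Sum>m\<in>Poly_Mapping.keys p. Poly_Mapping.single (m - Poly_Mapping.single v 1)
     (of_nat (Poly_Mapping.lookup m v) * Poly_Mapping.lookup p m))"

lemma pdiff_single:
  "pdiff v (Poly_Mapping.single m c) =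
    Poly_Mapping.single (m - Poly_Mapping.single v 1) (of_nat (Poly_Mapping.lookup m v) * c)"
  by (simp add: pdiff_def)

lemma pdiff_add: "pdiff v (p + q) = pdiff v p + pdiff v q"
  unfolding pdiff_def
  by (rule setsum_keys_plus_distrib) (simp_all add: single_add distrib_left)

lemma lookup_pdiff:
  "Poly_Mapping.lookup (pdiff v p) m =
    of_nat (Suc (Poly_Mapping.lookup m v)) * Poly_Mapping.lookup p (m + Poly_Mapping.single v 1)"
proof (induction p rule: mpoly_induct_single)
  case (single n c)
  show ?case
  proof (cases "Poly_Mapping.lookup n v = 0")
    case True
    then have "n \<noteq> m + Poly_Mapping.single v 1"
      by (auto simp: lookup_add)
    with True show ?thesis
      by (simp add: pdiff_single lookup_single)
  next
    case False
    then have "n - Poly_Mapping.single v 1 + Poly_Mapping.single v 1 = n"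
      by (intro poly_mapping_eqI) (auto simp: lookup_add lookup_minus lookup_single when_def)
    then have "n - Poly_Mapping.single v 1 = m \<longleftrightarrow> n = m + Poly_Mapping.single v 1"
      by auto
    then show ?thesis
      by (auto simp: pdiff_single lookup_single when_def lookup_add)
  qed
qed (simp add: pdiff_add lookup_add distrib_left)

lemma pdiff_mult: "pdiff v (p * q) = p * pdiff v q + q * pdiff v p"
proof (induction p rule: mpoly_induct_single)
  case (single m c)
  show ?case
  proof (induction q rule: mpoly_induct_single)
    case (single n d)
    let ?e = "Poly_Mapping.single v (1::nat)"
    \<comment> \<open>Truncated subtraction commutes with adding a only if v occurs in b; otherwise
      both sides have coefficient 0.\<close>
    have *: "Poly_Mapping.single (a + (b - ?e)) (of_nat (Poly_Mapping.lookup b v) * x)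
        = Poly_Mapping.single (a + b - ?e) (of_nat (Poly_Mapping.lookup b v) * x)" for a b and x :: 'b
    proof (cases "Poly_Mapping.lookup b v = 0")
      case False
      then have "a + (b - ?e) = a + b - ?e"
        by (intro poly_mapping_eqI) (auto simp: lookup_add lookup_minus lookup_single when_def)
      then show ?thesis by simp
    qed simp
    have "Poly_Mapping.single m c * pdiff v (Poly_Mapping.single n d)
          + Poly_Mapping.single n d * pdiff v (Poly_Mapping.single m c)
        = Poly_Mapping.single (m + (n - ?e)) (of_nat (Poly_Mapping.lookup n v) * (c * d))
          + Poly_Mapping.single (n + (m - ?e)) (of_nat (Poly_Mapping.lookup m v) * (c * d))"
      by (simp add: pdiff_single mult_single ac_simps)
    also have "\<dots> = pdiff v (Poly_Mapping.single m c * Poly_Mapping.single n d)"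
      unfolding * by (simp add: pdiff_single mult_single lookup_add add.commute distrib_right
          flip: single_add)
    finally show ?case by simp
  qed (simp add: pdiff_add algebra_simps)
qed (simp add: pdiff_add algebra_simps)

lemma pdiff_Const [simp]: "pdiff v (Const c) = 0"
  by (simp add: Const_def pdiff_single)

lemma pdiff_Var: "pdiff v (Var u) = (if u = v then 1 else 0)"
  by (simp add: Var_def pdiff_single lookup_single)

lemma is_derivation_pdiff: "is_derivation (pdiff v)"
  by (simp add: is_derivation_def pdiff_add pdiff_mult)

lemma keys_pdiff_funpow:
  "m \<in> Poly_Mapping.keys ((pdiff v ^^ k) p) \<Longrightarrow> m + Poly_Mapping.single v k \<in> Poly_Mapping.keys p"
proof (induction k arbitrary: m)
  case (Suc k)
  then have "m + Poly_Mapping.single v 1 \<in> Poly_Mapping.keys ((pdiff v ^^ k) p)"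
    by (auto simp: in_keys_iff lookup_pdiff)
  moreover have "m + Poly_Mapping.single v 1 + Poly_Mapping.single v k = m + Poly_Mapping.single v (Suc k)"
    by (rule poly_mapping_eqI) (simp add: lookup_add lookup_single when_def)
  ultimately show ?case
    using Suc.IH by metis
qed simp

lemma locally_nilpotent_pdiff: "locally_nilpotent (pdiff v)"
  unfolding locally_nilpotent_def
proof
  fix p :: "('a, 'b) mpoly"
  \<comment> \<open>The sum bounds every exponent of v in p and also makes sense for p = 0, so k
    differentiations exceed them all.\<close>
  define k where "k = Suc (\<Sum>m\<in>Poly_Mapping.keys p. Poly_Mapping.lookup m v)"
  have "m \<notin> Poly_Mapping.keys ((pdiff v ^^ k) p)" for m
  proof
    assume "m \<in> Poly_Mapping.keys ((pdiff v ^^ k) p)"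
    then have "m + Poly_Mapping.single v k \<in> Poly_Mapping.keys p"
      by (rule keys_pdiff_funpow)
    then have "Poly_Mapping.lookup (m + Poly_Mapping.single v k) v < k"
      unfolding k_def less_Suc_eq_le
      using member_le_sum[of _ "Poly_Mapping.keys p" "\<lambda>m. Poly_Mapping.lookup m v"] by simp
    then show False
      by (simp add: lookup_add)
  qed
  then show "\<exists>k. (pdiff v ^^ k) p = 0"
    using keys_eq_empty by blast
qed

lemma hcomp_pdiff: "hcomp w (r - w v) (pdiff v p) = pdiff v (hcomp w r p)"
proof (rule poly_mapping_eqI)
  fix m
  have "mon_wdeg w (m + Poly_Mapping.single v 1) = mon_wdeg w m + w v"
    by (simp add: mon_wdeg_add)
  then have "mon_wdeg w m = r - w v \<longleftrightarrow> mon_wdeg w (m + Poly_Mapping.single v 1) = r"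
    by linarith
  then show "Poly_Mapping.lookup (hcomp w (r - w v) (pdiff v p)) m
      = Poly_Mapping.lookup (pdiff v (hcomp w r p)) m"
    by (simp add: lookup_hcomp lookup_pdiff mult_when)
qed

lemma wle_pdiff:
  assumes "wle w r p"
  shows "wle w (r - w v) (pdiff v p)"
  unfolding wle_def
proof
  fix m
  assume "m \<in> Poly_Mapping.keys (pdiff v p)"
  then have "m + Poly_Mapping.single v 1 \<in> Poly_Mapping.keys p"
    by (auto simp: in_keys_iff lookup_pdiff)
  then have "mon_wdeg w (m + Poly_Mapping.single v 1) \<le> r"
    using assms by (simp add: wle_def)
  then show "mon_wdeg w m \<le> r - w v"
    by (simp add: mon_wdeg_add)
qed

section \<open>Top homogeneous parts of derivations\<close>

lemma is_derivation_combination: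
  fixes a :: "'v::finite \<Rightarrow> ('v, 'a::comm_ring_1) mpoly"
  shows "is_derivation (\<lambda>p. \<Sum>v\<in>UNIV. a v * pdiff v p)"
proof -
  have Const: "pdiff v (Const c * p) = Const c * pdiff v p" for v :: 'v and c :: 'a and p
    by (simp add: pdiff_mult)
  show ?thesis
    unfolding is_derivation_def sum_distrib_left sum.distrib[symmetric] Const pdiff_add pdiff_mult
    by (intro conjI allI sum.cong refl) (simp_all add: algebra_simps)
qed

text \<open>Both sides are derivations with the same values on the variables.\<close>

lemma derivation_expand:
  fixes D :: "('v::finite, 'a::comm_ring_1) mpoly \<Rightarrow> ('v, 'a) mpoly"
  assumes D: "is_derivation D"
  shows "D p = (\<Sum>v\<in>UNIV. D (Var v) * pdiff v p)"
proof -
  define E where "E p = (\<Sum>v\<in>UNIV. D (Var v) * pdiff v p)" for p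
  have E: "is_derivation E"
    unfolding E_def[abs_def] by (rule is_derivation_combination)
  have "D p = E p"
  proof (induction p rule: mpoly_induct)
    case (Var u)
    have "D (Var v) * pdiff v (Var u) = (if v = u then D (Var v) else 0)" for v
      by (auto simp: pdiff_Var)
    then show ?case by (simp add: E_def)
  qed (simp_all add: derivation_Const derivation_add derivation_mult D E)
  then show ?thesis by (simp add: E_def)
qed

text \<open>The homogeneous part of degree e of D for the weights d, given by its values on the
  variables. It is the top part when D raises weights by at most e.\<close>

definition top_derivation ::
  "('v::finite \<Rightarrow> real) \<Rightarrow> real \<Rightarrow> (('v, 'a::comm_ring_1) mpoly \<Rightarrow> ('v, 'a) mpoly) \<Rightarrow> ('v, 'a) mpoly \<Rightarrow> ('v, 'a) mpoly" where
  "top_derivation d e D p = (\<Sum>v\<in>UNIV. hcomp d (d v + e) (D (Var v)) * pdiff v p)"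

lemma is_derivation_top: "is_derivation (top_derivation d e D)"
  using is_derivation_combination by (simp add: top_derivation_def[abs_def])

lemma top_derivation_Var: "top_derivation d e D (Var v) = hcomp d (d v + e) (D (Var v))"
  by (simp add: top_derivation_def pdiff_Var if_distrib sum.delta cong: if_cong)

text \<open>\<open>pdiff v\<close> lowers weights by \<open>d v\<close> and \<open>D (Var v)\<close>
  has weight at most \<open>d v + e\<close>, so every summand of the expansion of D p is bounded by
  \<open>r + e\<close>.\<close>

lemma top_derivation:
  assumes D: "is_derivation D" "\<And>v. wle d (d v + e) (D (Var v))" and p: "wle d r p"
  shows "wle d (r + e) (D p)" "hcomp d (r + e) (D p) = top_derivation d e D (hcomp d r p)"
proof -
  have eq: "d v + e + (r - d v) = r + e" for v
    by simp
  have "wle d (r + e) (D (Var v) * pdiff v p)" for v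
    using wle_mult[OF D(2) wle_pdiff[OF p], of v v] by (simp only: eq)
  then show "wle d (r + e) (D p)"
    by (subst derivation_expand[OF D(1)]) (rule wle_sum)
  have "hcomp d (r + e) (D (Var v) * pdiff v p) = hcomp d (d v + e) (D (Var v)) * pdiff v (hcomp d r p)" for v
    using hcomp_mult[OF D(2) wle_pdiff[OF p], of v v] by (simp only: eq hcomp_pdiff)
  then show "hcomp d (r + e) (D p) = top_derivation d e D (hcomp d r p)"
    by (subst derivation_expand[OF D(1)]) (simp add: top_derivation_def hcomp_sum)
qed

lemma top_derivation_funpow:
  assumes D: "is_derivation D" "\<And>v. wle d (d v + e) (D (Var v))" and p: "wle d r p"
  shows "wle d (r + real k * e) ((D ^^ k) p) \<and>
    hcomp d (r + real k * e) ((D ^^ k) p) = (top_derivation d e D ^^ k) (hcomp d r p)"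
proof (induction k)
  case 0
  show ?case using p by simp
next
  case (Suc k)
  have eq: "r + real (Suc k) * e = r + real k * e + e"
    by (simp add: algebra_simps)
  show ?case
    unfolding eq using top_derivation[OF D conjunct1[OF Suc]] Suc by simp
qed

text \<open>On a homogeneous component, the k-th power of the top part is a component of the k-th
  power of D, hence 0 for large k. A polynomial is a finite sum of such components.\<close>

lemma locally_nilpotent_top:
  assumes D: "is_derivation D" "\<And>v. wle d (d v + e) (D (Var v))" and nil: "locally_nilpotent D"
  shows "locally_nilpotent (top_derivation d e D)"
  unfolding locally_nilpotent_def
proof
  fix p
  let ?T = "top_derivation d e D"
  have "\<exists>k. (?T ^^ k) (hcomp d r p) = 0" for r
  proof -
    obtain k where "(D ^^ k) (hcomp d r p) = 0"
      using nil by (auto simp: locally_nilpotent_def)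
    then have "(?T ^^ k) (hcomp d r (hcomp d r p)) = 0"
      using top_derivation_funpow[OF D wle_hcomp[of d r p], of k] by simp
    then show ?thesis by (auto simp: hcomp_hcomp)
  qed
  then have "\<exists>k. (?T ^^ k) (\<Sum>r\<in>mon_wdeg d ` Poly_Mapping.keys p. hcomp d r p) = 0"
    by (intro nilpotent_on_sum is_derivation_top)
  then show "\<exists>k. (?T ^^ k) p = 0"
    by (simp add: sum_hcomp)
qed

section \<open>Invariance of the relation ideal\<close>

text \<open>Positive weights give a nonconstant polynomial positive degree, so each monomial of its
  leading form contains a variable; characteristic zero keeps the derivative there nonzero.\<close>

lemma lead_form_depends_on_variable:
  fixes p :: "('v::finite, 'a::{comm_ring_1, semiring_char_0, semiring_no_zero_divisors}) mpoly"
  assumes w: "\<And>v. w v > 0" and p: "\<And>c. p \<noteq> Const c"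
  shows "\<exists>v. pdiff v (lead_form w p) \<noteq> 0"
proof -
  obtain n where n: "n \<in> Poly_Mapping.keys p" "n \<noteq> 0"
  proof (rule ccontr)
    assume "\<not> thesis"
    with that have "Poly_Mapping.keys p \<subseteq> {0}"
      by blast
    then have "p = Const (Poly_Mapping.lookup p 0)"
      by (intro poly_mapping_eqI) (auto simp: Const_def lookup_single when_def in_keys_iff)
    with p show False by blast
  qed
  then obtain u where "Poly_Mapping.lookup n u \<noteq> 0"
    using poly_mapping_eqI[of n 0] by auto
  then have "0 < mon_wdeg w n"
    unfolding mon_wdeg_def using w by (intro sum_pos2[of UNIV u]) (auto simp: less_imp_le)
  also have "\<dots> \<le> wdeg w p"
    using wle_wdeg[of w p] n by (simp add: wle_def)
  finally have pos: "0 < wdeg w p" .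
  have "p \<noteq> 0"
    using p[of 0] by simp
  then have "Poly_Mapping.keys (lead_form w p) \<noteq> {}"
    using hcomp_wdeg_nonzero[of p w] by (simp add: lead_form_eq_hcomp)
  then obtain m where m: "m \<in> Poly_Mapping.keys (lead_form w p)"
    by blast
  then have "m \<noteq> 0"
    using pos by (auto simp: lead_form_eq_hcomp keys_hcomp)
  then obtain v where v: "Poly_Mapping.lookup m v \<noteq> 0"
    using poly_mapping_eqI[of m 0] by auto
  let ?e = "Poly_Mapping.single v 1"
  have "m - ?e + ?e = m"
    using v by (intro poly_mapping_eqI) (auto simp: lookup_add lookup_minus lookup_single when_def)
  then have "Poly_Mapping.lookup (pdiff v (lead_form w p)) (m - ?e) \<noteq> 0"
    using m by (simp add: lookup_pdiff in_keys_iff del: of_nat_Suc)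
  then show ?thesis
    by (intro exI[of _ v]) auto
qed

text \<open>Links relations to degree drops: for p of weight at most r, the component of p of weight
  r is a relation exactly when \<open>subst f p\<close> has no component of weight r.\<close>

lemma lead_forms_hcomp:
  assumes "wle (\<lambda>v. wdeg w (f v)) r p"
  shows "wle w r (subst f p)"
    and "hcomp w r (subst f p) = subst (\<lambda>v. lead_form w (f v)) (hcomp (\<lambda>v. wdeg w (f v)) r p)"
  using wle_subst[of w "\<lambda>v. wdeg w (f v)" f r p] hcomp_subst[of w "\<lambda>v. wdeg w (f v)" f r p] assms
  by (simp_all add: wle_wdeg lead_form_eq_hcomp)

text \<open>The ideal is the kernel of a graded map, hence homogeneous.\<close>

lemma relation_ideal_hcomp:
  assumes "p \<in> relation_ideal w f"
  shows "hcomp (\<lambda>v. wdeg w (f v)) r p \<in> relation_ideal w f"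
  using assms hcomp_subst_homog[of w "\<lambda>v. wdeg w (f v)" "\<lambda>v. lead_form w (f v)" r p]
  by (simp add: relation_ideal_def hcomp_lead_form)

lemma relation_ideal_sum:
  "(\<And>x. x \<in> A \<Longrightarrow> h x \<in> relation_ideal w f) \<Longrightarrow> sum h A \<in> relation_ideal w f"
  by (simp add: relation_ideal_def subst_sum)

theorem theorem1:
  fixes w :: "'v::finite \<Rightarrow> real"
    and f :: "'v \<Rightarrow> ('v, 'a::{alg_closed_field, field_char_0}) mpoly"
  assumes "\<forall>v. w v > 0"
    and "poly_automorphism f"
  shows "\<exists>D. is_derivation D \<and> locally_nilpotent D \<and> D \<noteq> (\<lambda>_. 0)
            \<and> D ` relation_ideal w f \<subseteq> relation_ideal w f
            \<and> (\<forall>R. relation_ideal w f = {R * Q | Q. True} \<longrightarrow> D R = 0)"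
proof -
  obtain g where "\<And>i. subst g (f i) = Var i" "\<And>i. subst f (g i) = Var i"
    using assms(2) by (auto simp: poly_automorphism_def)
  note gf = subst_inverse[of g f, OF this(1)] and fg = subst_inverse[of f g, OF this(2)]
  define d where "d v = wdeg w (f v)" for v
  let ?lf = "\<lambda>v. lead_form w (f v)"
  \<comment> \<open>Types are inhabited, so some variable exists; any choice works.\<close>
  obtain j :: 'v where True by simp
  have "f j \<noteq> Const c" for c
  proof
    assume "f j = Const c"
    then have "Var j = (Const c :: ('v, 'a) mpoly)"
      using gf[of "Var j"] by (simp add: subst_Var subst_Const)
    then have "pdiff j (Var j) = pdiff j (Const c :: ('v, 'a) mpoly)"
      by (simp only:)
    then show False
      by (simp add: pdiff_Var)
  qed
  \<comment> \<open>Choosing i to occur in the leading form of \<open>f j\<close> keeps the degree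
    of D from falling below \<open>- w i\<close>.\<close>
  then obtain i where i: "pdiff i (lead_form w (f j)) \<noteq> 0"
    using lead_form_depends_on_variable[of w "f j"] assms(1) by auto

  define D where "D p = subst g (pdiff i (subst f p))" for p
  have FD: "subst f (D p) = pdiff i (subst f p)" for p
    by (simp add: D_def fg)
  have D: "is_derivation D"
    unfolding is_derivation_def D_def
    by (simp add: subst_add pdiff_add subst_mult pdiff_mult subst_Const gf)
  have "(D ^^ k) p = subst g ((pdiff i ^^ k) (subst f p))" for k p
    by (induction k) (simp_all add: D_def gf fg)
  then have D_nil: "locally_nilpotent D"
    using locally_nilpotent_pdiff[of i] unfolding locally_nilpotent_def by (metis subst_0)

  \<comment> \<open>S collects the amounts by which D shifts weights on the variables; its maximum e
    is the degree of D for the weights d.\<close>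
  define S where "S = (\<Union>v. (\<lambda>m. mon_wdeg d m - d v) ` Poly_Mapping.keys (D (Var v)))"
  define e where "e = Max S"
  have "finite S"
    by (simp add: S_def)
  \<comment> \<open>Here \<open>subst f (D (Var j))\<close> is the i-th partial derivative of
    \<open>f j\<close>, and this component is that of the leading form.\<close>
  have top_j: "hcomp w (d j - w i) (subst f (D (Var j))) \<noteq> 0"
    using i by (simp add: FD subst_Var hcomp_pdiff d_def lead_form_eq_hcomp)
  then have "D (Var j) \<noteq> 0"
    by auto
  then have "S \<noteq> {}"
    by (auto simp: S_def)
  have D_le: "wle d (d v + e) (D (Var v))" for v
    unfolding wle_def
  proof
    fix m assume "m \<in> Poly_Mapping.keys (D (Var v))"
    then have "mon_wdeg d m - d v \<in> S"
      by (auto simp: S_def)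
    then have "mon_wdeg d m - d v \<le> e"
      unfolding e_def using \<open>finite S\<close> by simp
    then show "mon_wdeg d m \<le> d v + e" by simp
  qed
  have e_ge: "- w i \<le> e"
  proof (rule ccontr)
    \<comment> \<open>Then \<open>subst f (D (Var j))\<close> would be bounded by
      \<open>d j + e\<close>, strictly below the weight \<open>d j - w i\<close> of its nonzero
      component.\<close>
    assume "\<not> - w i \<le> e"
    moreover have "wle w (d j + e) (subst f (D (Var j)))"
      using D_le[of j] lead_forms_hcomp(1)[of w f] by (simp add: d_def[abs_def])
    ultimately show False
      using top_j hcomp_eq_0 by fastforce
  qed
  let ?T = "top_derivation d e D"
  have T: "is_derivation ?T" "locally_nilpotent ?T"
    by (simp_all add: is_derivation_top locally_nilpotent_top[OF D D_le D_nil])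
  \<comment> \<open>The maximum is attained at some variable, where the part of degree e is
    therefore nonzero.\<close>
  have "e \<in> S"
    unfolding e_def using \<open>finite S\<close> \<open>S \<noteq> {}\<close> by (rule Max_in)
  then obtain v m where "m \<in> Poly_Mapping.keys (D (Var v))" "mon_wdeg d m = d v + e"
    by (auto simp: S_def)
  then have "m \<in> Poly_Mapping.keys (?T (Var v))"
    by (simp add: top_derivation_Var keys_hcomp)
  then have T_nz: "?T \<noteq> (\<lambda>_. 0)"
    by (metis keys_zero empty_iff)

  have homog: "?T p \<in> relation_ideal w f" if p: "p \<in> relation_ideal w f" "hcomp d r p = p" for r p
  proof -
    have p_le: "wle d r p"
      using wle_hcomp[of d r p] p by simp
    have "wle w r (subst f p)" "hcomp w r (subst f p) = 0"
      using lead_forms_hcomp[of w f r p] p p_le by (simp_all add: d_def[abs_def] relation_ideal_def)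
    \<comment> \<open>The strict drop in degree is kept as a weak bound plus a vanishing component.
      The component at \<open>r + e\<close> is then 0 by the latter if \<open>e = - w i\<close> and
      by the bound if e is larger.\<close>
    then have *: "wle w (r - w i) (subst f (D p))" "hcomp w (r - w i) (subst f (D p)) = 0"
      by (simp_all add: FD wle_pdiff hcomp_pdiff derivation_0[OF is_derivation_pdiff])
    have "hcomp w (r + e) (subst f (D p)) = 0"
    proof (cases "e = - w i")
      case False
      then show ?thesis
        using e_ge by (intro hcomp_eq_0[OF *(1)]) simp
    qed (use * in simp)
    moreover have "hcomp w (r + e) (subst f (D p)) = subst ?lf (?T p)"
      using lead_forms_hcomp(2)[of w f "r + e" "D p"] top_derivation[OF D D_le p_le] p(2)
      by (simp add: d_def[abs_def])
    ultimately show ?thesis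
      by (simp add: relation_ideal_def)
  qed
  have T_ideal: "?T p \<in> relation_ideal w f" if "p \<in> relation_ideal w f" for p
  proof -
    \<comment> \<open>Homogeneity of the ideal reduces the claim to the components of p.\<close>
    have "?T p = (\<Sum>r\<in>mon_wdeg d ` Poly_Mapping.keys p. ?T (hcomp d r p))"
      by (simp add: sum_hcomp flip: derivation_sum[OF T(1)])
    also have "\<dots> \<in> relation_ideal w f"
    proof (rule relation_ideal_sum)
      show "?T (hcomp d r p) \<in> relation_ideal w f" for r
        using relation_ideal_hcomp[OF that, of r]
        by (intro homog[of _ r]) (simp_all add: d_def[abs_def] hcomp_hcomp)
    qed
    finally show ?thesis .
  qed
  have "?T R = 0" if R: "relation_ideal w f = {R * Q | Q. True}" for R
  proof -
    \<comment> \<open>The generator lies in its own ideal, so invariance makes \<open>?T R\<close> a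
      multiple of R.\<close>
    have "R * 1 \<in> relation_ideal w f"
      unfolding R by blast
    then have "?T R \<in> relation_ideal w f"
      by (intro T_ideal) (simp only: mult_1_right)
    then obtain Q where "?T R = R * Q"
      unfolding R by blast
    then show ?thesis
      by (rule locally_nilpotent_dvd_imp_0[OF T])
  qed
  then show ?thesis
    using T T_nz T_ideal by (intro exI[of _ ?T] conjI allI impI image_subsetI)
qed

end
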